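(* Under Assumptions A1, A2 and A3 (and the Kesten–Stigum convergence $\bm Z_n\rho^{-n}\to\bm bW$ a.s. with $W>0$ a.s.), the following hold: (1) $\mathbb P(D_n)\to 1$ as $n\to\infty$; (2) if $K<1$, then for every $\alpha\in(0,-\log_\rho K)$, $\rho^{\alpha n}r_n^{-2}\bigl(1-\mathbb P(D_n)\bigr)\to0$ as $n\to\infty$.
   Context: Fix an integer $l\ge 2$, let $\mathbb N=\{0,1,2,\dots\}$, and for $\bm x\in\mathbb R^l$ let $|\bm x|=\sum_{i=1}^l|x_i|$. Let $p_1,\dots,p_l$ be probability mass functions on $\mathbb N^l$. The multitype Galton–Watson process $(\bm Z_n)_{n\ge0}$, $\bm Z_n=(Z_{n,1},\dots,Z_{n,l})$, is defined by $\bm Z_0$ equal to a fixed canonical basis vector and $\bm Z_n=\sum_{j=1}^l\sum_{i=1}^{Z_{n-1,j}}\bm Y^{(j)}_{n-1,i}$, where the offspring vectors $\bm Y^{(j)}_{n-1,i}$ are mutually independent and $\bm Y^{(j)}_{n-1,i}$ has law $p_j$; $\bm Y^{(i)}$ denotes a generic vector with law $p_i$. The mean matrix $M$ has entries $M_{ik}=\mathbb E(Y^{(i)}_k)$. Assumption A1: for every $j$, $p_j(\bm 0)=0$ and $\sum_{k=1}^l p_j(\bm e_k)<1$. Assumption A2: $M$ is positively regular (some power has all entries positive) and its largest eigenvalue $\rho$ satisfies $\rho>1$; $\bm b$ is the left eigenvector for $\rho$ with nonnegative entries and $|\bm b|=1$. Sampling: for a sequence of positive integers $r_n$, at generation $n$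 a sample of $r_n$ individuals is drawn uniformly at random without replacement among the $|\bm Z_n|$ individuals of generation $n$; each sampled individual reports the offspring vector of its parent (an individual of generation $n-1$). $D_n$ is the event that the $r_n$ sampled individuals have pairwise distinct parents (no two sampled individuals are siblings). Assumption A3: (i) $r_n^2\rho^{-n}\to0$; (ii) there is $C$ with $\mathbb E(|\bm Y^{(i)}|^2)\le C$ for all $i$; (iii) there is $K$ with $\mathbb E(|\bm Y^{(i)}|^{-1})\le K$ for all $i$. *)

theory Defs
  imports "HOL-Probability.Probability"
begin

primrec matpow :: "'a::semiring_1 ^'n^'n \<Rightarrow> nat \<Rightarrow> 'a^'n^'n" where
  "matpow A 0 = mat 1"
| "matpow A (Suc m) = matpow A m ** A"

definition positively_regular :: "real^'n^'n \<Rightarrow> bool" where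
  "positively_regular A \<longleftrightarrow> (\<exists>m. \<forall>i k. matpow A m $ i $ k > 0)"

definition complexify :: "real^'n^'n \<Rightarrow> complex^'n^'n" where
  "complexify A = (\<chi> i k. complex_of_real (A $ i $ k))"

definition is_eigenvalue :: "real^'n^'n \<Rightarrow> complex \<Rightarrow> bool" where
  "is_eigenvalue A c \<longleftrightarrow> (\<exists>v. v \<noteq> 0 \<and> complexify A *v v = c *s v)"

definition largest_eigenvalue :: "real^'n^'n \<Rightarrow> real \<Rightarrow> bool" where
  "largest_eigenvalue A \<rho> \<longleftrightarrow> is_eigenvalue A (complex_of_real \<rho>) \<and>
     (\<forall>c. is_eigenvalue A c \<longrightarrow> cmod c \<le> \<rho>)"

text \<open>Types are the elements of the finite type 'l; offspring vectors are in nat^'l.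
  Y j n i is the offspring vector of the i-th individual of type j in generation n.\<close>

definition mean_matrix :: "('l::finite \<Rightarrow> (nat^'l) pmf) \<Rightarrow> real^'l^'l" where
  "mean_matrix p = (\<chi> i k. measure_pmf.expectation (p i) (\<lambda>y. real (y $ k)))"

definition vnorm :: "nat^'l::finite \<Rightarrow> nat" where
  "vnorm y = (\<Sum>k\<in>UNIV. y $ k)"

primrec gw_Z :: "('l::finite \<Rightarrow> nat \<Rightarrow> nat \<Rightarrow> 'a \<Rightarrow> nat^'l) \<Rightarrow> 'l \<Rightarrow> nat \<Rightarrow> 'a \<Rightarrow> nat^'l" where
  "gw_Z Y j0 0 \<omega> = axis j0 1"
| "gw_Z Y j0 (Suc n) \<omega> = (\<Sum>j\<in>UNIV. \<Sum>i<gw_Z Y j0 n \<omega> $ j. Y j n i \<omega>)"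

text \<open>Individuals of generation n+1: (j,i,k,c) is the c-th child of type k of the
  i-th individual of type j of generation n; its parent is (j,i).\<close>
definition gw_ind :: "('l::finite \<Rightarrow> nat \<Rightarrow> nat \<Rightarrow> 'a \<Rightarrow> nat^'l) \<Rightarrow> 'l \<Rightarrow> nat \<Rightarrow> 'a
    \<Rightarrow> ('l \<times> nat \<times> 'l \<times> nat) set" where
  "gw_ind Y j0 n \<omega> = {(j,i,k,c). i < gw_Z Y j0 n \<omega> $ j \<and> c < Y j n i \<omega> $ k}"

definition gw_parent :: "'l \<times> nat \<times> 'l \<times> nat \<Rightarrow> 'l \<times> nat" where
  "gw_parent x = (case x of (j,i,k,c) \<Rightarrow> (j,i))"

text \<open>Conditional probability, given the process, of the event D_(n+1): a sample of
  r individuals drawn uniformly without replacement from generation n+1 has pairwise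
  distinct parents. (If fewer than r individuals exist the value is 0.)\<close>
definition D_condprob :: "('l::finite \<Rightarrow> nat \<Rightarrow> nat \<Rightarrow> 'a \<Rightarrow> nat^'l) \<Rightarrow> 'l \<Rightarrow> nat \<Rightarrow> nat \<Rightarrow> 'a \<Rightarrow> real" where
  "D_condprob Y j0 r n \<omega> =
     real (card {S. S \<subseteq> gw_ind Y j0 n \<omega> \<and> card S = r \<and> inj_on gw_parent S})
   / real (card {S. S \<subseteq> gw_ind Y j0 n \<omega> \<and> card S = r})"

text \<open>P(D_n) for generation n (n \<ge> 1); the value at n = 0 is irrelevant.\<close>
definition prob_D :: "'a measure \<Rightarrow> ('l::finite \<Rightarrow> nat \<Rightarrow> nat \<Rightarrow> 'a \<Rightarrow> nat^'l) \<Rightarrow> 'l \<Rightarrow> (nat \<Rightarrow> nat) \<Rightarrow> nat \<Rightarrow> real" where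
  "prob_D M Y j0 r n = (case n of 0 \<Rightarrow> 1
     | Suc m \<Rightarrow> integral\<^sup>L M (D_condprob Y j0 (r (Suc m)) m))"

end

(*
  Every individual has at least one child, so generation n + 1 has at least |Z_n| members, and the
  union bound over pairs of siblings gives
    1 - P(D_{n+1} | process) <= r^2 / |Z_n|^2 * (sum over the parents of |Y|^2).
  Offspring vectors of generation n are independent of Z_n, hence
    1 - P(D_{n+1}) <= E min(1, C r^2 / |Z_n|).
  Part (1) is dominated convergence, since |Z_n| grows like rho^n W with W > 0.
  For part (2) the inequality between harmonic and arithmetic means yields
  E(1 / |Z_{n+1}|) <= K E(1 / |Z_n|), hence 1 - P(D_{n+1}) <= C r^2 K^n.
*)
theory Submission
  imports Defs
begin

section \<open>Counting samples that contain siblings\<close>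

text \<open>Union bound: a set on which \<open>f\<close> is not injective contains two distinct
  points with the same image, and a fixed such pair lies in at most as many \<open>r\<close>-subsets
  as there are ways to choose the other \<open>r - 2\<close> elements. Adding the diagonal pairs
  only enlarges the bound; with them the number of pairs is a plain sum of squared fibre
  sizes.\<close>

lemma card_non_inj_subsets_le:
  fixes f :: "'b \<Rightarrow> 'c"
  assumes A: "finite A" and r: "2 \<le> r"
  shows "card {S. S \<subseteq> A \<and> card S = r \<and> \<not> inj_on f S}
    \<le> card {(x, y) \<in> A \<times> A. f x = f y} * (card A - 2 choose (r - 2))"
proof -
  define P where "P = {(x, y) \<in> A \<times> A. f x = f y \<and> x \<noteq> y}"
  define Q where "Q x y = {S. S \<subseteq> A \<and> card S = r \<and> x \<in> S \<and> y \<in> S}" for x y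
  have fin: "finite P" "finite {(x, y) \<in> A \<times> A. f x = f y}"
    using A by (auto simp: P_def intro: finite_subset[of _ "A \<times> A"])
  have Q: "card (Q x y) \<le> (card A - 2 choose (r - 2))" if "(x, y) \<in> P" for x y
  proof -
    have xy: "x \<in> A" "y \<in> A" "x \<noteq> y" using that by (auto simp: P_def)
    have "Q x y \<subseteq> (\<lambda>T. insert x (insert y T)) ` {T. T \<subseteq> A - {x, y} \<and> card T = r - 2}"
    proof
      fix S assume "S \<in> Q x y"
      then have S: "S \<subseteq> A" "card S = r" "x \<in> S" "y \<in> S" by (auto simp: Q_def)
      have "card (S - {x, y}) = r - 2"
        using S xy by (subst card_Diff_subset) auto
      moreover have "S = insert x (insert y (S - {x, y}))" using S by auto
      ultimately show "S \<in> (\<lambda>T. insert x (insert y T)) ` {T. T \<subseteq> A - {x, y} \<and> card T = r - 2}"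
        using S by blast
    qed
    then have "card (Q x y) \<le> card {T. T \<subseteq> A - {x, y} \<and> card T = r - 2}"
      using A by (intro surj_card_le) auto
    also have "\<dots> = (card (A - {x, y}) choose (r - 2))"
      using A by (intro n_subsets) auto
    also have "card (A - {x, y}) = card A - 2"
      using A xy by (subst card_Diff_subset) auto
    finally show ?thesis .
  qed
  have "{S. S \<subseteq> A \<and> card S = r \<and> \<not> inj_on f S} \<subseteq> (\<Union>(x, y)\<in>P. Q x y)"
    by (force simp: inj_on_def P_def Q_def)
  then have "card {S. S \<subseteq> A \<and> card S = r \<and> \<not> inj_on f S} \<le> card (\<Union>(x, y)\<in>P. Q x y)"
    using fin A by (intro card_mono finite_UN_I) (auto simp: Q_def)
  also have "\<dots> \<le> (\<Sum>(x, y)\<in>P. card (Q x y))"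
    using card_UN_le[OF fin(1), of "\<lambda>(x, y). Q x y"] by (simp add: case_prod_beta)
  also have "\<dots> \<le> card P * (card A - 2 choose (r - 2))"
    using Q by (intro sum_bounded_above[THEN order_trans]) auto
  also have "\<dots> \<le> card {(x, y) \<in> A \<times> A. f x = f y} * (card A - 2 choose (r - 2))"
    using fin by (intro mult_right_mono card_mono) (auto simp: P_def)
  finally show ?thesis .
qed

text \<open>Applying the absorption identity twice shows that the ratio equals
  \<open>r (r - 1) / (n (n - 1))\<close>, and \<open>(r - 1) / (n - 1) \<le> r / n\<close> because
  \<open>r \<le> n\<close>.\<close>

lemma binomial_minus2_ratio_le:
  assumes "2 \<le> r" "r \<le> n"
  shows "real (n - 2 choose (r - 2)) / real (n choose r) \<le> real r ^ 2 / real n ^ 2"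
proof -
  have "r * (r - 1) * (n choose r) = n * (n - 1) * (n - 2 choose (r - 2))"
    using times_binomial_minus1_eq[of r n] times_binomial_minus1_eq[of "r - 1" "n - 1"] assms
    by (simp add: mult.assoc numeral_2_eq_2) (metis mult.left_commute)
  then have "real (r * (r - 1)) * real (n choose r) = real (n * (n - 1)) * real (n - 2 choose (r - 2))"
    by (metis of_nat_mult)
  then have "real (n - 2 choose (r - 2)) / real (n choose r) = real (r * (r - 1)) / real (n * (n - 1))"
    using assms by (simp add: field_simps)
  also have "\<dots> = (real r / real n) * ((real r - 1) / (real n - 1))"
    using assms by (simp add: of_nat_diff)
  also have "\<dots> \<le> (real r / real n) * (real r / real n)"
  proof (rule mult_left_mono)
    show "(real r - 1) / (real n - 1) \<le> real r / real n"
      using assms by (simp add: field_simps)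
  qed auto
  finally show ?thesis by (simp add: power2_eq_square)
qed

text \<open>For \<open>r > card A\<close> the fraction is \<open>0 / 0 = 0\<close>; the diagonal pairs keep the bound true.\<close>

lemma non_inj_fraction_le:
  fixes f :: "'b \<Rightarrow> 'c"
  assumes A: "finite A" "A \<noteq> {}"
  shows "1 - real (card {S. S \<subseteq> A \<and> card S = r \<and> inj_on f S})
            / real (card {S. S \<subseteq> A \<and> card S = r})
    \<le> real r ^ 2 / real (card A) ^ 2 * real (card {(x, y) \<in> A \<times> A. f x = f y})"
    (is "1 - real ?g / real ?t \<le> ?R")
proof -
  have pos: "card A > 0" using A by (simp add: card_gt_0_iff)
  have finP: "finite {(x, y) \<in> A \<times> A. f x = f y}"
    using A by (auto intro: finite_subset[of _ "A \<times> A"])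
  have t: "?t = (card A choose r)" using A(1) by (rule n_subsets)
  consider "r \<le> 1" | "2 \<le> r" "r \<le> card A" | "card A < r" by linarith
  then show ?thesis
  proof cases
    case 1
    have "inj_on f S" if "S \<subseteq> A" "card S = r" for S
      using that 1 finite_subset[OF that(1) A(1)] by (auto simp: inj_on_def card_le_Suc0_iff_eq)
    then have "{S. S \<subseteq> A \<and> card S = r \<and> inj_on f S} = {S. S \<subseteq> A \<and> card S = r}" by auto
    moreover have "?t > 0" using 1 pos by (simp add: t)
    ultimately have "1 - real ?g / real ?t = 0" by simp
    then show ?thesis by (simp only:) simp
  next
    case 2
    let ?b = "card {S. S \<subseteq> A \<and> card S = r \<and> \<not> inj_on f S}"
    have tgb: "?t = ?g + ?b"
      using A by (subst card_Un_disjoint[symmetric]) (auto intro!: arg_cong[where f = card])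
    have "?t > 0" using 2 by (simp add: t)
    then have "1 - real ?g / real ?t = (real ?t - real ?g) / real ?t"
      by (simp add: diff_divide_distrib)
    also have "real ?t - real ?g = real ?b" by (simp only: tgb of_nat_add)
    also have "real ?b / real ?t \<le> real (card {(x, y) \<in> A \<times> A. f x = f y} * (card A - 2 choose (r - 2))) / real ?t"
      using card_non_inj_subsets_le[OF A(1) 2(1), of f] by (intro divide_right_mono) (auto simp del: of_nat_mult)
    also have "\<dots> = real (card {(x, y) \<in> A \<times> A. f x = f y}) * (real (card A - 2 choose (r - 2)) / real (card A choose r))"
      by (simp add: t)
    also have "\<dots> \<le> real (card {(x, y) \<in> A \<times> A. f x = f y}) * (real r ^ 2 / real (card A) ^ 2)"
      by (intro mult_left_mono binomial_minus2_ratio_le 2) auto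
    finally show ?thesis by (simp add: mult.commute)
  next
    case 3
    have "card A = card ((\<lambda>x. (x, x)) ` A)" by (simp add: card_image inj_on_def)
    also have "\<dots> \<le> card {(x, y) \<in> A \<times> A. f x = f y}"
      using finP by (intro card_mono) auto
    finally have *: "card A \<le> card {(x, y) \<in> A \<times> A. f x = f y}" .
    have "1 \<le> real r ^ 2 / real (card A)^2"
      using 3 pos by (simp add: power_mono)
    moreover have "1 \<le> real (card {(x, y) \<in> A \<times> A. f x = f y})" using * pos by linarith
    ultimately have "1 * 1 \<le> ?R" by (intro mult_mono) auto
    moreover have "1 - real ?g / real ?t \<le> 1" by simp
    ultimately show ?thesis by linarith
  qed
qed

section \<open>Family structure of two consecutive generations\<close>

text \<open>Individuals are labelled as in the values of \<open>gw_parent\<close>. The double sum in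
  the recursion for \<open>gw_Z\<close> becomes one sum over this finite set, which depends on the
  process only through the type counts.\<close>

definition parents :: "nat^'l::finite \<Rightarrow> ('l \<times> nat) set" where
  "parents z = (SIGMA j:UNIV. {..<z $ j})"

lemma finite_parents [simp]: "finite (parents z)"
  by (simp add: parents_def)

lemma card_parents [simp]: "card (parents z) = vnorm z"
  by (simp add: parents_def vnorm_def)

lemma vnorm_eq_0_iff [simp]: "vnorm y = 0 \<longleftrightarrow> y = 0"
  by (simp add: vnorm_def vec_eq_iff)

lemma vnorm_0 [simp]: "vnorm 0 = 0"
  by simp

lemma vnorm_sum: "vnorm (\<Sum>i\<in>I. f i) = (\<Sum>i\<in>I. vnorm (f i))"
  by (simp add: vnorm_def sum.swap[of _ I])

lemma vnorm_gw_Z_Suc: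
  "vnorm (gw_Z Y j0 (Suc n) \<omega>) = (\<Sum>(j, i)\<in>parents (gw_Z Y j0 n \<omega>). vnorm (Y j n i \<omega>))"
  by (simp add: vnorm_sum parents_def sum.Sigma case_prod_beta)

text \<open>Generation \<open>n + 1\<close> is the disjoint union of the families \<open>F q\<close>
  of the parents \<open>q\<close>, and the ordered pairs with a common parent form the disjoint
  union of the squares \<open>F q \<times> F q\<close>. The sum of squares is what the second moment
  assumption controls.\<close>

lemma gw_siblings:
  fixes Y :: "'l::finite \<Rightarrow> nat \<Rightarrow> nat \<Rightarrow> 'a \<Rightarrow> nat^'l" and j0 n \<omega>
  defines "A \<equiv> gw_ind Y j0 n \<omega>"
  defines "Z \<equiv> gw_Z Y j0 n \<omega>"
  shows finite_gw_ind: "finite A"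
    and card_gw_ind: "card A = (\<Sum>(j, i)\<in>parents Z. vnorm (Y j n i \<omega>))"
    and card_sibling_pairs: "card {(x, y) \<in> A \<times> A. gw_parent x = gw_parent y}
      = (\<Sum>(j, i)\<in>parents Z. vnorm (Y j n i \<omega>) ^ 2)"
proof -
  define F where "F q = (\<lambda>(k, c). (fst q, snd q, k, c)) ` parents (Y (fst q) n (snd q) \<omega>)" for q
  have finF: "finite (F q)" for q by (simp add: F_def)
  have cardF: "card (F q) = vnorm (Y (fst q) n (snd q) \<omega>)" for q
    unfolding F_def by (subst card_image) (auto simp: inj_on_def)
  have disjF: "F q \<inter> F q' = {}" if "q \<noteq> q'" for q q'
    using that by (auto simp: F_def prod_eq_iff)
  have A: "A = (\<Union>q\<in>parents Z. F q)"
    by (force simp: A_def gw_ind_def Z_def F_def parents_def image_iff)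
  show "finite A" unfolding A using finF by simp
  show "card A = (\<Sum>(j, i)\<in>parents Z. vnorm (Y j n i \<omega>))"
    unfolding A using finF disjF by (subst card_UN_disjoint) (auto simp: cardF case_prod_beta)
  have par: "gw_parent x = q" if "x \<in> F q" for x q
    using that by (auto simp: F_def gw_parent_def)
  have "{(x, y) \<in> A \<times> A. gw_parent x = gw_parent y} = (\<Union>q\<in>parents Z. F q \<times> F q)"
    unfolding A using par by (auto; metis)
  moreover have "card \<dots> = (\<Sum>q\<in>parents Z. card (F q \<times> F q))"
    using finF disjF by (intro card_UN_disjoint) (auto simp: Times_Int_Times)
  ultimately show "card {(x, y) \<in> A \<times> A. gw_parent x = gw_parent y}
      = (\<Sum>(j, i)\<in>parents Z. vnorm (Y j n i \<omega>) ^ 2)"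
    by (simp add: card_cartesian_product cardF case_prod_beta power2_eq_square)
qed

lemma vnorm_gw_Z_mono:
  assumes "\<And>j i. Y j n i \<omega> \<noteq> 0"
  shows "vnorm (gw_Z Y j0 n \<omega>) \<le> vnorm (gw_Z Y j0 (Suc n) \<omega>)"
proof -
  have "(\<Sum>q\<in>parents (gw_Z Y j0 n \<omega>). 1) \<le> (\<Sum>(j, i)\<in>parents (gw_Z Y j0 n \<omega>). vnorm (Y j n i \<omega>))"
    using assms by (intro sum_mono) (auto simp: Suc_le_eq simp flip: vnorm_eq_0_iff)
  then show ?thesis by (simp only: vnorm_gw_Z_Suc) simp
qed

text \<open>The process starts with one individual and never shrinks, so the later divisions by the
  population size are genuine.\<close>

lemma vnorm_gw_Z_ge_1:
  assumes "\<And>j m i. Y j m i \<omega> \<noteq> 0"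
  shows "1 \<le> vnorm (gw_Z Y j0 n \<omega>)"
proof (induction n)
  case 0
  show ?case by (simp add: vnorm_def axis_def)
next
  case (Suc n)
  then show ?case using vnorm_gw_Z_mono[of Y n \<omega> j0] assms by fastforce
qed

lemma D_condprob_bounds: "0 \<le> D_condprob Y j0 r n \<omega>" "D_condprob Y j0 r n \<omega> \<le> 1"
proof -
  have "card {S. S \<subseteq> gw_ind Y j0 n \<omega> \<and> card S = r \<and> inj_on gw_parent S}
      \<le> card {S. S \<subseteq> gw_ind Y j0 n \<omega> \<and> card S = r}"
    using finite_gw_ind[of Y j0 n \<omega>] by (intro card_mono) auto
  then show "D_condprob Y j0 r n \<omega> \<le> 1"
    by (auto simp: D_condprob_def divide_le_eq_1)
qed (simp add: D_condprob_def)

text \<open>The sampling bound has the size of generation \<open>n + 1\<close> in its denominator.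
  Replacing it by the smaller size of generation \<open>n\<close> leaves a factor that depends on
  \<open>Z_n\<close> alone, hence is independent of the offspring vectors in the sum.\<close>

lemma one_minus_D_condprob_le:
  assumes nz: "\<And>j m i. Y j m i \<omega> \<noteq> 0"
  shows "1 - D_condprob Y j0 r n \<omega> \<le> real r ^ 2 / real (vnorm (gw_Z Y j0 n \<omega>)) ^ 2
    * (\<Sum>(j, i)\<in>parents (gw_Z Y j0 n \<omega>). real (vnorm (Y j n i \<omega>)) ^ 2)"
proof -
  let ?A = "gw_ind Y j0 n \<omega>"
  let ?P = "card {(x, y) \<in> ?A \<times> ?A. gw_parent x = gw_parent y}"
  have N: "1 \<le> vnorm (gw_Z Y j0 n \<omega>)" "vnorm (gw_Z Y j0 n \<omega>) \<le> card ?A"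
    using vnorm_gw_Z_ge_1[of Y \<omega> j0 n] vnorm_gw_Z_mono[of Y n \<omega> j0] nz
    by (auto simp: card_gw_ind simp flip: vnorm_gw_Z_Suc)
  then have "0 < card ?A" by linarith
  then have "?A \<noteq> {}" by (metis card.empty less_irrefl)
  then have "1 - D_condprob Y j0 r n \<omega> \<le> real r ^ 2 / real (card ?A) ^ 2 * real ?P"
    unfolding D_condprob_def by (intro non_inj_fraction_le finite_gw_ind)
  also have "\<dots> \<le> real r ^ 2 / real (vnorm (gw_Z Y j0 n \<omega>)) ^ 2 * real ?P"
    using N by (intro mult_right_mono divide_left_mono power_mono mult_pos_pos) auto
  also have "real ?P = (\<Sum>(j, i)\<in>parents (gw_Z Y j0 n \<omega>). real (vnorm (Y j n i \<omega>)) ^ 2)"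
    unfolding card_sibling_pairs by (simp add: case_prod_beta)
  finally show ?thesis .
qed

section \<open>Harmonic and arithmetic means\<close>

text \<open>Cauchy-Schwarz for the vectors with entries \<open>sqrt (a i)\<close> and
  \<open>1 / sqrt (a i)\<close>, whose products are all 1.\<close>

lemma card_squared_le_sum_mult_sum_inverse:
  fixes a :: "'b \<Rightarrow> real"
  assumes "\<And>i. i \<in> I \<Longrightarrow> a i > 0"
  shows "real (card I) ^ 2 \<le> (\<Sum>i\<in>I. a i) * (\<Sum>i\<in>I. 1 / a i)"
proof -
  have "(\<Sum>i\<in>I. sqrt (a i) * (1 / sqrt (a i)))\<^sup>2
      \<le> (\<Sum>i\<in>I. (sqrt (a i))\<^sup>2) * (\<Sum>i\<in>I. (1 / sqrt (a i))\<^sup>2)"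
    by (rule Cauchy_Schwarz_ineq_sum)
  also have "(\<Sum>i\<in>I. sqrt (a i) * (1 / sqrt (a i))) = (\<Sum>i\<in>I. 1)"
    using assms by (intro sum.cong) force+
  also have "(\<Sum>i\<in>I. (sqrt (a i))\<^sup>2) = (\<Sum>i\<in>I. a i)"
    using assms by (intro sum.cong) (auto simp: less_imp_le)
  also have "(\<Sum>i\<in>I. (1 / sqrt (a i))\<^sup>2) = (\<Sum>i\<in>I. 1 / a i)"
    using assms by (intro sum.cong) (auto simp: less_imp_le power_divide)
  finally show ?thesis by simp
qed

text \<open>The preceding inequality with the family sizes as \<open>a\<close>: their number is the
  size of generation \<open>n\<close> and their sum the size of generation \<open>n + 1\<close>. The
  right side is again a function of \<open>Z_n\<close> times a sum over parents.\<close>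

lemma inverse_vnorm_gw_Z_Suc_le:
  assumes nz: "\<And>j m i. Y j m i \<omega> \<noteq> 0"
  shows "1 / real (vnorm (gw_Z Y j0 (Suc n) \<omega>)) \<le> 1 / real (vnorm (gw_Z Y j0 n \<omega>)) ^ 2
    * (\<Sum>(j, i)\<in>parents (gw_Z Y j0 n \<omega>). 1 / real (vnorm (Y j n i \<omega>)))"
proof -
  define V N S where "V = vnorm (gw_Z Y j0 n \<omega>)" and "N = vnorm (gw_Z Y j0 (Suc n) \<omega>)"
    and "S = (\<Sum>(j, i)\<in>parents (gw_Z Y j0 n \<omega>). 1 / real (vnorm (Y j n i \<omega>)))"
  have pos: "V \<ge> 1" "N \<ge> 1"
    unfolding V_def N_def using vnorm_gw_Z_ge_1[of Y \<omega>] nz by blast+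
  have "real V ^ 2 \<le> real N * S"
    using card_squared_le_sum_mult_sum_inverse
      [of "parents (gw_Z Y j0 n \<omega>)" "\<lambda>(j, i). real (vnorm (Y j n i \<omega>))"] nz
    unfolding vnorm_gw_Z_Suc V_def N_def S_def
    by (auto simp: case_prod_beta neq0_conv[symmetric] simp del: neq0_conv)
  then have "1 / real N \<le> 1 / real V ^ 2 * S"
    using pos by (simp add: field_simps)
  then show ?thesis by (simp only: V_def N_def S_def)
qed

section \<open>Measurability of the process and of the sampling probability\<close>

text \<open>A finite product of countable discrete spaces is discrete, so \<open>F\<close> may be
  any function at all. This disposes of counting expressions such as
  \<open>D_condprob\<close>.\<close>

lemma measurable_finite_family:
  fixes X :: "'i \<Rightarrow> 'a \<Rightarrow> 'b::countable" and F :: "('i \<Rightarrow> 'b) \<Rightarrow> 'c"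
  assumes I: "finite I" and X: "\<And>i. i \<in> I \<Longrightarrow> X i \<in> N \<rightarrow>\<^sub>M count_space UNIV"
    and F: "range F \<subseteq> space L"
  shows "(\<lambda>\<omega>. F (restrict (\<lambda>i. X i \<omega>) I)) \<in> N \<rightarrow>\<^sub>M L"
proof -
  have "(\<lambda>\<omega>. restrict (\<lambda>i. X i \<omega>) I) \<in> N \<rightarrow>\<^sub>M PiM I (\<lambda>_. count_space UNIV)"
    using X by (rule measurable_restrict)
  also have "PiM I (\<lambda>_. count_space (UNIV :: 'b set)) = count_space (PiE I (\<lambda>_. UNIV))"
    using I by (intro count_space_PiM_finite) auto
  finally show ?thesis
    by (rule measurable_compose) (use F in auto)
qed

text \<open>Only generations before \<open>n\<close> are assumed measurable, so that the lemma also
  applies to coordinate maps on a product space that has just those coordinates.\<close>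

lemma measurable_gw_Z:
  fixes Y :: "'l::finite \<Rightarrow> nat \<Rightarrow> nat \<Rightarrow> 'a \<Rightarrow> nat^'l"
  assumes "\<And>j m i. m < n \<Longrightarrow> Y j m i \<in> N \<rightarrow>\<^sub>M count_space UNIV"
  shows "gw_Z Y j0 n \<in> N \<rightarrow>\<^sub>M count_space UNIV"
  using assms
proof (induction n)
  case 0
  then show ?case by simp
next
  case (Suc n)
  define F where "F z h = (\<Sum>j\<in>UNIV. \<Sum>i<z $ j. h (j, i))" for z :: "nat^'l" and h :: "'l \<times> nat \<Rightarrow> nat^'l"
  have F: "F z (restrict h (parents z)) = F z h" for z h
    by (auto simp: F_def parents_def intro!: sum.cong)
  have "(\<lambda>\<omega>. F z (restrict (\<lambda>q. Y (fst q) n (snd q) \<omega>) (parents z))) \<in> N \<rightarrow>\<^sub>M count_space UNIV" for z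
    using Suc.prems by (intro measurable_finite_family) auto
  \<comment> \<open>The number of summands is random, so the population is first frozen at a value
    \<open>z\<close>; there are only countably many values to glue.\<close>
  from measurable_compose_countable[OF this Suc.IH] Suc.prems show ?case
    by (simp add: F) (simp add: F_def)
qed

lemma measurable_D_condprob:
  fixes Y :: "'l::finite \<Rightarrow> nat \<Rightarrow> nat \<Rightarrow> 'a \<Rightarrow> nat^'l"
  assumes Y: "\<And>j m i. Y j m i \<in> N \<rightarrow>\<^sub>M count_space UNIV"
  shows "D_condprob Y j0 r n \<in> borel_measurable N"
proof -
  define B where "B z h = {(j, i, k, c). i < z $ j \<and> c < h (j, i) $ k}"
    for z :: "nat^'l" and h :: "'l \<times> nat \<Rightarrow> nat^'l"
  define F where "F z h = real (card {S. S \<subseteq> B z h \<and> card S = r \<and> inj_on gw_parent S})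
    / real (card {S. S \<subseteq> B z h \<and> card S = r})" for z h
  \<comment> \<open>The condition \<open>i < z $ j\<close> already forces \<open>(j, i)\<close> into
    \<open>parents z\<close>, so only finitely many offspring vectors matter.\<close>
  have "B z (restrict h (parents z)) = B z h" for z h
    by (auto simp: B_def parents_def)
  then have F: "F z (restrict h (parents z)) = F z h" for z h
    by (simp add: F_def)
  have "(\<lambda>\<omega>. F z (restrict (\<lambda>q. Y (fst q) n (snd q) \<omega>) (parents z))) \<in> borel_measurable N" for z
    using Y by (intro measurable_finite_family) auto
  from measurable_compose_countable[OF this measurable_gw_Z[where n = n and ?j0.0 = j0 and Y = Y, OF Y]]
  have "(\<lambda>\<omega>. F (gw_Z Y j0 n \<omega>) (\<lambda>q. Y (fst q) n (snd q) \<omega>)) \<in> borel_measurable N"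
    by (simp add: F)
  also have "(\<lambda>\<omega>. F (gw_Z Y j0 n \<omega>) (\<lambda>q. Y (fst q) n (snd q) \<omega>)) = D_condprob Y j0 r n"
    by (simp add: F_def B_def D_condprob_def gw_ind_def fun_eq_iff)
  finally show ?thesis .
qed

section \<open>Independence of offspring from the current population\<close>

text \<open>The pair is read as a family indexed by \<open>bool\<close>, for which the expectation
  of a product factorises. With values in \<open>ennreal\<close>, no integrability has to be
  checked.\<close>

lemma (in prob_space) nn_integral_indep_mult:
  assumes "indep_var N1 X1 N2 X2" "f \<in> borel_measurable N1" "g \<in> borel_measurable N2"
  shows "(\<integral>\<^sup>+\<omega>. f (X1 \<omega>) * g (X2 \<omega>) \<partial>M) = (\<integral>\<^sup>+\<omega>. f (X1 \<omega>) \<partial>M) * (\<integral>\<^sup>+\<omega>. g (X2 \<omega>) \<partial>M)"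
proof -
  have "indep_var borel (f \<circ> X1) borel (g \<circ> X2)"
    using assms by (rule indep_var_compose)
  moreover have "(case_bool borel borel :: bool \<Rightarrow> ennreal measure) = (\<lambda>_. borel)" by (auto split: bool.split)
  ultimately have "indep_vars (\<lambda>_. borel) (case_bool (f \<circ> X1) (g \<circ> X2)) UNIV"
    by (simp add: indep_var_def)
  from indep_vars_nn_integral[OF _ this] show ?thesis by (simp add: UNIV_bool mult.commute comp_def)
qed

locale gw_process = prob_space M for M :: "'a measure" +
  fixes p :: "'l::finite \<Rightarrow> (nat^'l) pmf"
    and Y :: "'l \<Rightarrow> nat \<Rightarrow> nat \<Rightarrow> 'a \<Rightarrow> nat^'l"
    and j0 :: 'l
  assumes indep: "indep_vars (\<lambda>_. count_space UNIV) (\<lambda>(j,n,i). Y j n i) UNIV"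
    and law: "measure M {\<omega>\<in>space M. Y j n i \<omega> = y} = pmf (p j) y"
    and no_leaves: "pmf (p j) 0 = 0"
begin

abbreviation "Z \<equiv> gw_Z Y j0"

lemma measurable_Y [measurable]: "Y j n i \<in> M \<rightarrow>\<^sub>M count_space UNIV"
  using indep by (auto simp: indep_vars_def)

lemma measurable_Z [measurable]: "Z n \<in> M \<rightarrow>\<^sub>M count_space UNIV"
  by (intro measurable_gw_Z measurable_Y)

lemma distr_Y: "distr M (count_space UNIV) (Y j n i) = measure_pmf (p j)"
proof (rule measure_eqI_countable)
  fix y :: "nat^'l"
  have "Y j n i -` {y} \<inter> space M = {\<omega>\<in>space M. Y j n i \<omega> = y}" by auto
  then show "emeasure (distr M (count_space UNIV) (Y j n i)) {y} = emeasure (measure_pmf (p j)) {y}"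
    by (simp add: emeasure_distr emeasure_eq_measure law emeasure_pmf_single)
qed auto

lemma nn_integral_Y: "(\<integral>\<^sup>+\<omega>. g (Y j n i \<omega>) \<partial>M) = (\<integral>\<^sup>+y. g y \<partial>measure_pmf (p j))"
  by (simp flip: distr_Y[of j n i] add: nn_integral_distr)

text \<open>There are countably many labels, so a single null set serves for all of them.\<close>

lemma AE_Y_nonzero: "AE \<omega> in M. \<forall>j m i. Y j m i \<omega> \<noteq> 0"
proof -
  have "AE \<omega> in M. Y j m i \<omega> \<noteq> 0" for j m i
  proof -
    have "{\<omega>\<in>space M. \<not> Y j m i \<omega> \<noteq> 0} \<in> null_sets M"
      using law[of j m i 0] by (auto simp: null_sets_def emeasure_eq_measure no_leaves)
    then show ?thesis by (rule AE_I') auto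
  qed
  then show ?thesis by (simp add: AE_all_countable)
qed

text \<open>\<open>Z n\<close> reads only offspring vectors of generations before \<open>n\<close>,
  a block of labels disjoint from \<open>(j, n, i)\<close>.\<close>

lemma indep_Z_Y: "indep_var (count_space UNIV) (Z n) (count_space UNIV) (Y j n i)"
proof -
  let ?A = "{(j, m, i) :: 'l \<times> nat \<times> nat | j m i. m < n}" and ?B = "{(j, n, i)}"
  let ?X = "\<lambda>(j, n, i). Y j n i"
  let ?P = "\<lambda>A. PiM A (\<lambda>_. count_space UNIV) :: ('l \<times> nat \<times> nat \<Rightarrow> nat^'l) measure"
  \<comment> \<open>The same recursion run on the coordinate space, which exhibits
    \<open>Z n\<close> as a measurable function of the restricted family.\<close>
  define Z' where "Z' = gw_Z (\<lambda>j m i f. f (j, m, i)) j0 n"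
  have "indep_var (?P ?A) (\<lambda>\<omega>. restrict (\<lambda>q. ?X q \<omega>) ?A) (?P ?B) (\<lambda>\<omega>. restrict (\<lambda>q. ?X q \<omega>) ?B)"
    by (rule indep_var_restrict[OF indep]) auto
  moreover have "Z' \<in> ?P ?A \<rightarrow>\<^sub>M count_space UNIV"
    unfolding Z'_def by (intro measurable_gw_Z measurable_component_singleton) auto
  moreover have "(\<lambda>f. f (j, n, i)) \<in> ?P ?B \<rightarrow>\<^sub>M count_space UNIV"
    by (intro measurable_component_singleton) auto
  ultimately have "indep_var (count_space UNIV) (Z' \<circ> (\<lambda>\<omega>. restrict (\<lambda>q. ?X q \<omega>) ?A))
      (count_space UNIV) ((\<lambda>f. f (j, n, i)) \<circ> (\<lambda>\<omega>. restrict (\<lambda>q. ?X q \<omega>) ?B))"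
    by (rule indep_var_compose)
  moreover have "gw_Z (\<lambda>j m i f. f (j, m, i)) j0 k (restrict (\<lambda>q. ?X q \<omega>) ?A) = Z k \<omega>"
    if "k \<le> n" for k \<omega>
    using that by (induction k) auto
  ultimately show ?thesis by (simp add: Z'_def comp_def)
qed

text \<open>Offspring vectors of generation \<open>n\<close> are independent of \<open>Z n\<close>, so each parent contributes
  at most \<open>c\<close> on average even though the set of parents is random.\<close>

lemma nn_integral_sum_parents_le:
  fixes h g :: "nat^'l \<Rightarrow> ennreal"
  assumes c: "\<And>j. (\<integral>\<^sup>+y. g y \<partial>measure_pmf (p j)) \<le> c"
  shows "(\<integral>\<^sup>+\<omega>. h (Z n \<omega>) * (\<Sum>(j, i)\<in>parents (Z n \<omega>). g (Y j n i \<omega>)) \<partial>M)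
    \<le> c * (\<integral>\<^sup>+\<omega>. h (Z n \<omega>) * of_nat (vnorm (Z n \<omega>)) \<partial>M)"
proof -
  \<comment> \<open>The indicator moves the randomness of the index set into the summand: the sum
    then runs over all labels and can be exchanged with the expectation.\<close>
  define u where "u q z = h z * indicator (parents z) q" for q z
  define G where "G q \<omega> = g (Y (fst q) n (snd q) \<omega>)" for q \<omega>
  have count: "(\<integral>\<^sup>+q. u q z * v q \<partial>count_space UNIV) = h z * (\<Sum>q\<in>parents z. v q)" for z v
    by (subst nn_integral_count_space'[of "parents z"])
       (auto simp: u_def sum_distrib_left)
  have u_meas [measurable]: "(\<lambda>\<omega>. u q (Z n \<omega>)) \<in> borel_measurable M" for q
    by (rule measurable_compose[OF measurable_Z]) simp
  have G_meas [measurable]: "G q \<in> borel_measurable M" for q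
    unfolding G_def by (rule measurable_compose[OF measurable_Y]) simp
  have "(\<integral>\<^sup>+\<omega>. h (Z n \<omega>) * (\<Sum>(j, i)\<in>parents (Z n \<omega>). g (Y j n i \<omega>)) \<partial>M)
      = (\<integral>\<^sup>+\<omega>. \<integral>\<^sup>+q. u q (Z n \<omega>) * G q \<omega> \<partial>count_space UNIV \<partial>M)"
    by (simp add: count G_def case_prod_beta)
  also have "\<dots> = (\<integral>\<^sup>+q. \<integral>\<^sup>+\<omega>. u q (Z n \<omega>) * G q \<omega> \<partial>M \<partial>count_space UNIV)"
    by (rule nn_integral_count_space_nn_integral) auto
  \<comment> \<open>For a fixed label \<open>q\<close>, the first factor is a function of
    \<open>Z n\<close> and the second of one offspring vector of generation
    \<open>n\<close>.\<close>
  also have "\<dots> = (\<integral>\<^sup>+q. (\<integral>\<^sup>+\<omega>. u q (Z n \<omega>) \<partial>M) * (\<integral>\<^sup>+\<omega>. G q \<omega> \<partial>M) \<partial>count_space UNIV)"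
    unfolding G_def by (intro nn_integral_cong nn_integral_indep_mult[OF indep_Z_Y]) auto
  also have "\<dots> \<le> (\<integral>\<^sup>+q. (\<integral>\<^sup>+\<omega>. u q (Z n \<omega>) \<partial>M) * c \<partial>count_space UNIV)"
    by (intro nn_integral_mono mult_left_mono) (auto simp: G_def nn_integral_Y c)
  also have "\<dots> = (\<integral>\<^sup>+q. \<integral>\<^sup>+\<omega>. u q (Z n \<omega>) * c \<partial>M \<partial>count_space UNIV)"
    by (simp add: nn_integral_multc)
  also have "\<dots> = (\<integral>\<^sup>+\<omega>. \<integral>\<^sup>+q. u q (Z n \<omega>) * c \<partial>count_space UNIV \<partial>M)"
    by (rule nn_integral_count_space_nn_integral[symmetric]) auto
  also have "\<dots> = (\<integral>\<^sup>+\<omega>. c * (h (Z n \<omega>) * of_nat (vnorm (Z n \<omega>))) \<partial>M)"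
    by (simp add: count) (simp add: mult_ac)
  also have "\<dots> = c * (\<integral>\<^sup>+\<omega>. h (Z n \<omega>) * of_nat (vnorm (Z n \<omega>)) \<partial>M)"
    by (intro nn_integral_cmult measurable_compose[OF measurable_Z]) simp
  finally show ?thesis .
qed

section \<open>Expected inverse population size and expected sampling failure\<close>

text \<open>Each generation costs one factor \<open>K\<close>, by the mean inequality and the
  independence of the new offspring; the initial population has size 1.\<close>

lemma nn_integral_inverse_vnorm_Z_le:
  assumes K: "0 \<le> K" and inv: "\<And>j. (\<integral>\<^sup>+y. ennreal (1 / real (vnorm y)) \<partial>measure_pmf (p j)) \<le> ennreal K"
  shows "(\<integral>\<^sup>+\<omega>. ennreal (1 / real (vnorm (Z n \<omega>))) \<partial>M) \<le> ennreal (K ^ n)"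
proof (induction n)
  case 0
  show ?case by (simp add: vnorm_def axis_def emeasure_space_1)
next
  case (Suc n)
  let ?h = "\<lambda>z :: nat^'l. ennreal (1 / real (vnorm z) ^ 2)"
  have "(\<integral>\<^sup>+\<omega>. ennreal (1 / real (vnorm (Z (Suc n) \<omega>))) \<partial>M)
      \<le> (\<integral>\<^sup>+\<omega>. ?h (Z n \<omega>) * (\<Sum>(j, i)\<in>parents (Z n \<omega>). ennreal (1 / real (vnorm (Y j n i \<omega>)))) \<partial>M)"
  proof (rule nn_integral_mono_AE)
    show "AE \<omega> in M. ennreal (1 / real (vnorm (Z (Suc n) \<omega>)))
      \<le> ?h (Z n \<omega>) * (\<Sum>(j, i)\<in>parents (Z n \<omega>). ennreal (1 / real (vnorm (Y j n i \<omega>))))"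
      using AE_Y_nonzero
    proof eventually_elim
      case (elim \<omega>)
      have "ennreal (1 / real (vnorm (Z (Suc n) \<omega>))) \<le> ennreal (1 / real (vnorm (Z n \<omega>)) ^ 2
          * (\<Sum>(j, i)\<in>parents (Z n \<omega>). 1 / real (vnorm (Y j n i \<omega>))))"
        using elim by (intro ennreal_leI inverse_vnorm_gw_Z_Suc_le) auto
      also have "\<dots> = ?h (Z n \<omega>) * (\<Sum>(j, i)\<in>parents (Z n \<omega>). ennreal (1 / real (vnorm (Y j n i \<omega>))))"
        by (subst ennreal_mult) (auto simp: case_prod_beta intro!: sum_nonneg)
      finally show ?case .
    qed
  qed
  also have "\<dots> \<le> ennreal K * (\<integral>\<^sup>+\<omega>. ?h (Z n \<omega>) * of_nat (vnorm (Z n \<omega>)) \<partial>M)"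
    by (rule nn_integral_sum_parents_le[OF inv])
  also have "\<dots> = ennreal K * (\<integral>\<^sup>+\<omega>. ennreal (1 / real (vnorm (Z n \<omega>))) \<partial>M)"
  proof -
    \<comment> \<open>At \<open>z = 0\<close> both sides are 0, since division by zero yields
      0.\<close>
    have "?h z * of_nat (vnorm z) = ennreal (1 / real (vnorm z))" for z
      by (cases "z = 0")
         (simp_all add: power2_eq_square ennreal_of_nat_eq_real_of_nat flip: ennreal_mult')
    then show ?thesis by simp
  qed
  also have "\<dots> \<le> ennreal K * ennreal (K ^ n)"
    by (intro mult_left_mono Suc) auto
  finally show ?case using K by (simp flip: ennreal_mult')
qed

text \<open>The minimum stands inside the expectation, which supplies the bounded integrand for
  dominated convergence. It can be put there because the choice between the trivial bound 1 and the
  sibling bound is made from \<open>Z n\<close> alone.\<close>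

lemma nn_integral_one_minus_D_condprob_le:
  assumes C: "0 \<le> C" and sq: "\<And>j. (\<integral>\<^sup>+y. ennreal (real (vnorm y) ^ 2) \<partial>measure_pmf (p j)) \<le> ennreal C"
  shows "(\<integral>\<^sup>+\<omega>. ennreal (1 - D_condprob Y j0 r n \<omega>) \<partial>M)
    \<le> (\<integral>\<^sup>+\<omega>. ennreal (min 1 (C * real r ^ 2 * (1 / real (vnorm (Z n \<omega>))))) \<partial>M)"
proof -
  \<comment> \<open>\<open>big\<close> says that the averaged sibling bound
    \<open>C r^2 / |z|\<close> is below 1. There \<open>h\<close> carries the sibling bound;
    elsewhere \<open>k\<close> carries the trivial one.\<close>
  define big where "big z \<longleftrightarrow> C * real r ^ 2 < real (vnorm z)" for z :: "nat^'l"
  define h where "h z = (if big z then ennreal (real r ^ 2 / real (vnorm z) ^ 2) else 0)" for z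
  define k :: "nat^'l \<Rightarrow> ennreal" where "k z = (if big z then 0 else 1)" for z
  let ?S = "\<lambda>\<omega>. \<Sum>(j, i)\<in>parents (Z n \<omega>). ennreal (real (vnorm (Y j n i \<omega>)) ^ 2)"
  have Z_meas [measurable]: "(\<lambda>\<omega>. f (Z n \<omega>)) \<in> borel_measurable M" for f :: "nat^'l \<Rightarrow> ennreal"
    by (rule measurable_compose[OF measurable_Z]) simp
  have S_meas [measurable]: "?S \<in> borel_measurable M"
  proof -
    have "(\<lambda>\<omega>. \<Sum>q\<in>parents z. ennreal (real (vnorm (Y (fst q) n (snd q) \<omega>)) ^ 2)) \<in> borel_measurable M" for z
      by (intro borel_measurable_sum measurable_compose[OF measurable_Y]) simp
    from measurable_compose_countable[OF this measurable_Z] show ?thesis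
      by (simp add: case_prod_beta)
  qed
  have "(\<integral>\<^sup>+\<omega>. ennreal (1 - D_condprob Y j0 r n \<omega>) \<partial>M) \<le> (\<integral>\<^sup>+\<omega>. k (Z n \<omega>) + h (Z n \<omega>) * ?S \<omega> \<partial>M)"
  proof (rule nn_integral_mono_AE)
    show "AE \<omega> in M. ennreal (1 - D_condprob Y j0 r n \<omega>) \<le> k (Z n \<omega>) + h (Z n \<omega>) * ?S \<omega>"
      using AE_Y_nonzero
    proof eventually_elim
      case (elim \<omega>)
      show ?case
      proof (cases "big (Z n \<omega>)")
        case True
        have "ennreal (1 - D_condprob Y j0 r n \<omega>) \<le> ennreal (real r ^ 2 / real (vnorm (Z n \<omega>)) ^ 2
            * (\<Sum>(j, i)\<in>parents (Z n \<omega>). real (vnorm (Y j n i \<omega>)) ^ 2))"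
          using elim by (intro ennreal_leI one_minus_D_condprob_le) auto
        also have "\<dots> = h (Z n \<omega>) * ?S \<omega>"
          using True by (subst ennreal_mult) (auto simp: h_def case_prod_beta intro!: sum_nonneg)
        finally show ?thesis using True by (simp add: k_def)
      next
        case False
        then show ?thesis by (simp add: k_def h_def D_condprob_bounds)
      qed
    qed
  qed
  also have "\<dots> = (\<integral>\<^sup>+\<omega>. k (Z n \<omega>) \<partial>M) + (\<integral>\<^sup>+\<omega>. h (Z n \<omega>) * ?S \<omega> \<partial>M)"
    by (rule nn_integral_add) auto
  also have "\<dots> \<le> (\<integral>\<^sup>+\<omega>. k (Z n \<omega>) \<partial>M) + ennreal C * (\<integral>\<^sup>+\<omega>. h (Z n \<omega>) * of_nat (vnorm (Z n \<omega>)) \<partial>M)"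
    by (intro add_left_mono nn_integral_sum_parents_le sq)
  also have "\<dots> = (\<integral>\<^sup>+\<omega>. k (Z n \<omega>) + ennreal C * (h (Z n \<omega>) * of_nat (vnorm (Z n \<omega>))) \<partial>M)"
    by (simp add: nn_integral_add nn_integral_cmult)
  also have "\<dots> = (\<integral>\<^sup>+\<omega>. ennreal (min 1 (C * real r ^ 2 * (1 / real (vnorm (Z n \<omega>))))) \<partial>M)"
  proof (rule nn_integral_cong_AE)
    show "AE \<omega> in M. k (Z n \<omega>) + ennreal C * (h (Z n \<omega>) * of_nat (vnorm (Z n \<omega>)))
        = ennreal (min 1 (C * real r ^ 2 * (1 / real (vnorm (Z n \<omega>)))))"
      using AE_Y_nonzero
    proof eventually_elim
      case (elim \<omega>)
      then have pos: "1 \<le> vnorm (Z n \<omega>)" by (intro vnorm_gw_Z_ge_1) auto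
      show ?case
      proof (cases "big (Z n \<omega>)")
        case True
        then have "C * real r ^ 2 * (1 / real (vnorm (Z n \<omega>))) \<le> 1"
          using pos by (simp add: big_def field_simps)
        then show ?thesis using True C pos
          by (simp add: k_def h_def ennreal_of_nat_eq_real_of_nat power2_eq_square min_absorb2 
             flip: ennreal_mult')
      next
        case False
        then have "1 \<le> C * real r ^ 2 * (1 / real (vnorm (Z n \<omega>)))"
          using pos by (simp add: big_def field_simps)
        then show ?thesis using False by (simp add: k_def h_def min_absorb1)
      qed
    qed
  qed
  finally show ?thesis .
qed

text \<open>Index shift: \<open>D_condprob\<close> with argument \<open>n\<close> concerns a sample
  from generation \<open>n + 1\<close>, whose parents live in generation \<open>n\<close>.\<close>

lemma one_minus_prob_D:
  "ennreal (1 - prob_D M Y j0 r (Suc n)) = (\<integral>\<^sup>+\<omega>. ennreal (1 - D_condprob Y j0 (r (Suc n)) n \<omega>) \<partial>M)"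
  "prob_D M Y j0 r n \<le> 1"
proof -
  have int: "integrable M (D_condprob Y j0 s n)" for s n
    by (rule integrable_const_bound[of _ 1])
       (auto simp: D_condprob_bounds intro!: measurable_D_condprob)
  have "1 - prob_D M Y j0 r (Suc n) = (\<integral>\<omega>. 1 - D_condprob Y j0 (r (Suc n)) n \<omega> \<partial>M)"
    using int by (simp add: prob_D_def prob_space)
  then show "ennreal (1 - prob_D M Y j0 r (Suc n)) = (\<integral>\<^sup>+\<omega>. ennreal (1 - D_condprob Y j0 (r (Suc n)) n \<omega>) \<partial>M)"
    using int by (subst nn_integral_eq_integral) (auto simp: D_condprob_bounds)
  have "(\<integral>\<omega>. D_condprob Y j0 s m \<omega> \<partial>M) \<le> (\<integral>\<omega>. 1 \<partial>M)" for s m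
    by (intro integral_mono int) (auto simp: D_condprob_bounds)
  then show "prob_D M Y j0 r n \<le> 1"
    by (auto simp: prob_D_def prob_space split: nat.split)
qed

end

section \<open>Dominated convergence and geometric decay of the failure probability\<close>

theorem theorem3p3:
  fixes M :: "'a measure"
    and p :: "'l::finite \<Rightarrow> (nat^'l) pmf"
    and Y :: "'l \<Rightarrow> nat \<Rightarrow> nat \<Rightarrow> 'a \<Rightarrow> nat^'l"
    and j0 :: 'l
    and r :: "nat \<Rightarrow> nat"
    and \<rho> :: real and b :: "real^'l"
    and C K :: real
    and W :: "'a \<Rightarrow> real"
  assumes l2: "CARD('l) \<ge> 2"
    and prob: "prob_space M"
    and indep: "prob_space.indep_vars M (\<lambda>_. count_space UNIV) (\<lambda>(j,n,i). Y j n i) UNIV"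
    and law: "\<And>j n i y. measure M {\<omega>\<in>space M. Y j n i \<omega> = y} = pmf (p j) y"
    and A1a: "\<And>j. pmf (p j) 0 = 0"
    and A1b: "\<And>j. (\<Sum>k\<in>UNIV. pmf (p j) (axis k 1)) < 1"
    and A2a: "positively_regular (mean_matrix p)"
    and A2b: "largest_eigenvalue (mean_matrix p) \<rho>"
    and A2c: "\<rho> > 1"
    and A2d: "b v* mean_matrix p = \<rho> *s b"
    and A2e: "\<forall>k. b $ k \<ge> 0"
    and A2f: "(\<Sum>k\<in>UNIV. b $ k) = 1"
    and r_pos: "\<And>n. r n > 0"
    and A3i: "(\<lambda>n. real (r n) ^ 2 / \<rho> ^ n) \<longlonglongrightarrow> 0"
    and A3ii: "\<And>j. (\<integral>\<^sup>+ y. ennreal (real (vnorm y) ^ 2) \<partial>measure_pmf (p j)) \<le> ennreal C"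
    and A3iii: "\<And>j. (\<integral>\<^sup>+ y. ennreal (1 / real (vnorm y)) \<partial>measure_pmf (p j)) \<le> ennreal K"
    and W_rv: "W \<in> borel_measurable M"
    and KS: "AE \<omega> in M. (\<lambda>n. (1 / \<rho> ^ n) *\<^sub>R (\<chi> k. real (gw_Z Y j0 n \<omega> $ k)))
                           \<longlonglongrightarrow> W \<omega> *\<^sub>R b"
    and W_pos: "AE \<omega> in M. W \<omega> > 0"
  shows "((\<lambda>n. prob_D M Y j0 r n) \<longlonglongrightarrow> 1) \<and>
         (K < 1 \<longrightarrow> (\<forall>\<alpha>. 0 < \<alpha> \<and> \<alpha> < - log \<rho> K \<longrightarrow>
           (\<lambda>n. \<rho> powr (\<alpha> * real n) / real (r n) ^ 2 * (1 - prob_D M Y j0 r n)) \<longlonglongrightarrow> 0))"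
proof -
  interpret gw_process M p Y j0
    using prob indep law A1a by (intro gw_process.intro gw_process_axioms.intro) auto
  \<comment> \<open>\<open>ennreal\<close> sends negative reals to 0, so the bound survives this
    change and the constant becomes nonnegative.\<close>
  define C' where "C' = max C 0"
  have C': "0 \<le> C'" "(\<integral>\<^sup>+ y. ennreal (real (vnorm y) ^ 2) \<partial>measure_pmf (p j)) \<le> ennreal C'" for j
    using A3ii[of j] by (auto simp: C'_def max_def ennreal_neg split: if_splits)
  define q where "q n = 1 - prob_D M Y j0 r (Suc n)" for n
  define f where "f n \<omega> = min 1 (C' * real (r (Suc n)) ^ 2 * (1 / real (vnorm (Z n \<omega>))))" for n \<omega>
  have q_nonneg: "0 \<le> q n" for n by (simp add: q_def one_minus_prob_D)
  have q_le: "ennreal (q n) \<le> (\<integral>\<^sup>+\<omega>. ennreal (f n \<omega>) \<partial>M)" for n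
    unfolding q_def f_def one_minus_prob_D(1) using C'
    by (rule nn_integral_one_minus_D_condprob_le)
  have f_bounds: "0 \<le> f n \<omega>" "f n \<omega> \<le> 1" for n \<omega> using C'(1) by (auto simp: f_def)
  have f_meas: "f n \<in> borel_measurable M" for n
    unfolding f_def by (rule measurable_compose[OF measurable_Z]) simp

  have "AE \<omega> in M. (\<lambda>n. f n \<omega>) \<longlonglongrightarrow> 0"
    using KS W_pos
  proof eventually_elim
    case (elim \<omega>)
    \<comment> \<open>Summing the coordinates of the vector limit and using that the entries of
      \<open>b\<close> sum to 1 gives the growth of the total population.\<close>
    have "(\<lambda>n. \<Sum>k\<in>UNIV. ((1 / \<rho> ^ n) *\<^sub>R (\<chi> k. real (Z n \<omega> $ k))) $ k)
        \<longlonglongrightarrow> (\<Sum>k\<in>UNIV. (W \<omega> *\<^sub>R b) $ k)"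
      using elim(1) by (intro tendsto_sum tendsto_vec_nth)
    then have "(\<lambda>n. real (vnorm (Z n \<omega>)) / \<rho> ^ n) \<longlonglongrightarrow> W \<omega>"
      using A2f by (simp add: vnorm_def flip: sum_distrib_left sum_divide_distrib)
    then have "(\<lambda>n. inverse (real (vnorm (Z n \<omega>)) / \<rho> ^ n)) \<longlonglongrightarrow> inverse (W \<omega>)"
      using elim(2) by (intro tendsto_inverse) auto
    \<comment> \<open>The extra factor \<open>\<rho>\<close> makes up for the sample being taken one
      generation after the population in the denominator.\<close>
    then have lim: "(\<lambda>n. C' * \<rho> * (real (r (Suc n)) ^ 2 / \<rho> ^ Suc n)
        * inverse (real (vnorm (Z n \<omega>)) / \<rho> ^ n)) \<longlonglongrightarrow> C' * \<rho> * 0 * inverse (W \<omega>)"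
      by (intro tendsto_mult tendsto_const LIMSEQ_Suc[OF A3i])
    have eq: "C' * \<rho> * (real (r (Suc n)) ^ 2 / \<rho> ^ Suc n) * inverse (real (vnorm (Z n \<omega>)) / \<rho> ^ n)
        = C' * real (r (Suc n)) ^ 2 * (1 / real (vnorm (Z n \<omega>)))" for n
      using A2c by (simp add: field_simps)
    have "(\<lambda>n. C' * real (r (Suc n)) ^ 2 * (1 / real (vnorm (Z n \<omega>)))) \<longlonglongrightarrow> 0"
      using lim unfolding eq mult_zero_right mult_zero_left .
    then have "(\<lambda>n. f n \<omega>) \<longlonglongrightarrow> min 1 0"
      unfolding f_def by (intro tendsto_min tendsto_const)
    then show ?case by simp
  qed
  then have "(\<lambda>n. \<integral>\<omega>. f n \<omega> \<partial>M) \<longlonglongrightarrow> (\<integral>\<omega>. 0 \<partial>M)"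
    using f_bounds by (intro integral_dominated_convergence[where w = "\<lambda>_. 1"] f_meas) auto
  moreover have "q n \<le> (\<integral>\<omega>. f n \<omega> \<partial>M)" for n
  proof -
    have "integrable M (f n)"
      using f_bounds by (intro integrable_const_bound[of _ 1] f_meas) auto
    then show ?thesis
      using q_le[of n] f_bounds by (subst (asm) nn_integral_eq_integral) auto
  qed
  ultimately have "q \<longlonglongrightarrow> 0"
    using q_nonneg by (intro tendsto_sandwich[of "\<lambda>_. 0" q _ "\<lambda>n. \<integral>\<omega>. f n \<omega> \<partial>M" 0]) auto
  then have "(\<lambda>n. 1 - q n) \<longlonglongrightarrow> 1 - 0" by (intro tendsto_diff tendsto_const)
  then have part1: "(\<lambda>n. prob_D M Y j0 r n) \<longlonglongrightarrow> 1"
    unfolding q_def by (subst filterlim_sequentially_Suc[symmetric]) simp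

  \<comment> \<open>Otherwise \<open>1 / |Y|\<close> would vanish almost surely, which under
    \<open>1 / 0 = 0\<close> means \<open>Y = 0\<close> almost surely, against the absence of
    leaves.\<close>
  have K_pos: "K > 0"
  proof (rule ccontr)
    assume "\<not> K > 0"
    then have "(\<integral>\<^sup>+ y. ennreal (1 / real (vnorm y)) \<partial>measure_pmf (p j0)) = 0"
      using A3iii[of j0] by (simp add: ennreal_neg)
    then have "\<forall>y\<in>set_pmf (p j0). y = 0"
      by (subst (asm) nn_integral_0_iff_AE) (auto simp: AE_measure_pmf_iff ennreal_eq_0_iff divide_le_0_iff)
    then show False
      using set_pmf_not_empty[of "p j0"] A1a[of j0] by (auto simp: set_pmf_eq)
  qed
  have q_le_K: "q n \<le> C' * real (r (Suc n)) ^ 2 * K ^ n" for n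
  proof -
    have "ennreal (q n) \<le> (\<integral>\<^sup>+\<omega>. ennreal (C' * real (r (Suc n)) ^ 2) * ennreal (1 / real (vnorm (Z n \<omega>))) \<partial>M)"
      using C'(1) by (intro order_trans[OF q_le] nn_integral_mono)
        (simp add: f_def flip: ennreal_mult')
    also have "\<dots> = ennreal (C' * real (r (Suc n)) ^ 2) * (\<integral>\<^sup>+\<omega>. ennreal (1 / real (vnorm (Z n \<omega>))) \<partial>M)"
      by (intro nn_integral_cmult measurable_compose[OF measurable_Z]) simp
    also have "\<dots> \<le> ennreal (C' * real (r (Suc n)) ^ 2) * ennreal (K ^ n)"
      using K_pos A3iii by (intro mult_left_mono nn_integral_inverse_vnorm_Z_le) auto
    also have "\<dots> = ennreal (C' * real (r (Suc n)) ^ 2 * K ^ n)"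
      using C'(1) by (simp flip: ennreal_mult')
    finally show ?thesis
      using C'(1) K_pos by (subst (asm) ennreal_le_iff) auto
  qed
  have part2: "(\<lambda>n. \<rho> powr (\<alpha> * real n) / real (r n) ^ 2 * (1 - prob_D M Y j0 r n)) \<longlonglongrightarrow> 0"
    if "\<alpha> < - log \<rho> K" for \<alpha>
  proof (rule LIMSEQ_imp_Suc)
    let ?x = "\<rho> powr \<alpha>"
    \<comment> \<open>The condition on \<open>\<alpha>\<close> amounts to
      \<open>\<rho> powr \<alpha> * K < 1\<close>, the ratio of a convergent geometric
      bound.\<close>
    have "?x < \<rho> powr (- log \<rho> K)" using that A2c by (intro powr_less_mono) auto
    also have "\<dots> = 1 / K" using A2c K_pos by (simp add: powr_minus_divide)
    finally have "?x * K < 1" using K_pos by (simp add: field_simps)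
    then have "(\<lambda>n. (?x * K) ^ n) \<longlonglongrightarrow> 0"
      using K_pos by (intro LIMSEQ_power_zero) simp
    then have lim: "(\<lambda>n. ?x * C' * (?x * K) ^ n) \<longlonglongrightarrow> 0"
      by (rule tendsto_mult_right_zero)
    \<comment> \<open>The squared sample size cancels. The leading \<open>?x\<close> is left over
      because the weight has exponent \<open>n + 1\<close> while \<open>K\<close> has exponent
      \<open>n\<close>.\<close>
    have upper: "\<rho> powr (\<alpha> * real (Suc n)) / real (r (Suc n)) ^ 2 * q n \<le> ?x * C' * (?x * K) ^ n" for n
    proof -
      have "\<rho> powr (\<alpha> * real (Suc n)) = ?x powr real (Suc n)"
        by (rule powr_powr[symmetric])
      also have "\<dots> = ?x ^ Suc n"
        using A2c by (intro powr_realpow) simp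
      finally have "\<rho> powr (\<alpha> * real (Suc n)) / real (r (Suc n)) ^ 2 * q n
          = ?x ^ Suc n / real (r (Suc n)) ^ 2 * q n"
        by (simp only:)
      also have "\<dots> \<le> ?x ^ Suc n / real (r (Suc n)) ^ 2 * (C' * real (r (Suc n)) ^ 2 * K ^ n)"
        using q_le_K[of n] by (rule mult_left_mono) simp
      also have "\<dots> = ?x * C' * (?x * K) ^ n"
        using r_pos[of "Suc n"] by (simp add: power_mult_distrib)
      finally show ?thesis .
    qed
    have lower: "0 \<le> \<rho> powr (\<alpha> * real (Suc n)) / real (r (Suc n)) ^ 2 * q n" for n
      by (intro mult_nonneg_nonneg divide_nonneg_nonneg q_nonneg) auto
    show "(\<lambda>n. \<rho> powr (\<alpha> * real (Suc n)) / real (r (Suc n)) ^ 2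
        * (1 - prob_D M Y j0 r (Suc n))) \<longlonglongrightarrow> 0"
      unfolding q_def[symmetric]
      by (rule tendsto_sandwich[OF _ _ tendsto_const lim])
         (intro always_eventually allI lower upper)+
  qed
  show ?thesis
    by (intro conjI impI allI part1 part2) simp
qed

end
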